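(* Let $n\ge 1$ be an integer, $\Delta\ge 0$ a real number and $p\in[0,1]$. Consider $n$ homogeneous nodes in the power capture model with parameter $\Delta$ and i.i.d. Rayleigh fading, where every node has average transmission probability $p$. Let $\rho$ be the average throughput (achievable average throughput demand) of a node when no CSI is available to the nodes, and let $\rho'$ be the average throughput (achievable average throughput demand) of a node when perfect CSI is available to all nodes (each node using its threshold strategy). Then $\rho'\le\rho$.
   Context: Setting (one time slot): nodes $1,\dots,n$ may transmit to a base station, each with the same power. Let $X_i=|h_i|^2$ be the channel power gain of node $i$; $X_1,\dots,X_n$ are i.i.d. exponential random variables with density $e^{-x}$, $x\ge 0$ (Rayleigh fading). Let $B_i\in\{0,1\}$ be the indicator that node $i$ transmits. Power capture model with parameter $\Delta\ge0$: node $i$'s packet is successfully received iff $$B_iX_i>\max_{j\ne i}\{(1+\Delta)B_jX_j\}$$ (a maximum over the empty set is read as $0$). The average throughput of node $i$ is the probability that its packet is successfully received. No CSI: $B_1,\dots,B_n$ are independent of each other and of $(X_1,\dots,X_n)$, with $\Pr[B_i=1]=p$. Perfect CSI: each node knows its own channel gain and uses the threshold strategy $B_i=1$ iff $X_i>T$, where the threshold $T\in[0,\infty]$ satisfies $e^{-T}=p$ (so the average transmission probability is $p$; $T=\infty$, i.e. never transmitting, if $p=0$). Since the nodes are homogeneous, the average throughput is the same for every node. The throughput demand achieved at the symmetric point $(p,\dots,p)$ is by definition the common average throughput at that point. *)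

theory Defs
  imports "HOL-Probability.Probability"
begin

locale rayleigh_fading = prob_space M for M :: "'a measure" +
  fixes n :: nat and X :: "nat \<Rightarrow> 'a \<Rightarrow> real"
  assumes X_exponential: "\<And>i. i \<in> {1..n} \<Longrightarrow> distributed M lborel (X i) (exponential_density 1)"
    and X_indep: "indep_vars (\<lambda>_. borel) X {1..n}"

locale no_csi = rayleigh_fading M n X
  for M :: "'a measure" and n :: nat and X :: "nat \<Rightarrow> 'a \<Rightarrow> real" +
  fixes p :: real and B :: "nat \<Rightarrow> 'a \<Rightarrow> real"
  assumes B_indicator: "\<And>i \<omega>. i \<in> {1..n} \<Longrightarrow> \<omega> \<in> space M \<Longrightarrow> B i \<omega> \<in> {0, 1}"
    and B_prob: "\<And>i. i \<in> {1..n} \<Longrightarrow> prob {\<omega> \<in> space M. B i \<omega> = 1} = p"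
    and B_indep: "indep_vars (\<lambda>_. borel) B {1..n}"
    and B_X_indep:
      "indep_var (Pi\<^sub>M {1..n} (\<lambda>_. borel)) (\<lambda>\<omega>. \<lambda>i\<in>{1..n}. B i \<omega>)
                 (Pi\<^sub>M {1..n} (\<lambda>_. borel)) (\<lambda>\<omega>. \<lambda>i\<in>{1..n}. X i \<omega>)"

text \<open>The function \<open>T \<mapsto> e\<^sup>-\<^sup>T\<close> on \<open>[0, \<infinity>]\<close>, with value 0 at \<open>\<infinity>\<close>.
  The value at \<open>-\<infinity>\<close> is irrelevant.\<close>

definition exp_neg :: "ereal \<Rightarrow> real" where
  "exp_neg T = (if \<bar>T\<bar> = \<infinity> then 0 else exp (- real_of_ereal T))"

definition threshold_strategy :: "ereal \<Rightarrow> (nat \<Rightarrow> 'a \<Rightarrow> real) \<Rightarrow> nat \<Rightarrow> 'a \<Rightarrow> real" where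
  "threshold_strategy T X i \<omega> = (if ereal (X i \<omega>) > T then 1 else 0)"

definition max_or_zero :: "real set \<Rightarrow> real" where
  "max_or_zero S = (if S = {} then 0 else Max S)"

definition received :: "real \<Rightarrow> nat \<Rightarrow> (nat \<Rightarrow> real) \<Rightarrow> (nat \<Rightarrow> real) \<Rightarrow> nat \<Rightarrow> bool" where
  "received \<Delta> n b x i \<longleftrightarrow>
     b i * x i > max_or_zero ((\<lambda>j. (1 + \<Delta>) * b j * x j) ` ({1..n} - {i}))"

definition avg_throughput ::
  "'a measure \<Rightarrow> real \<Rightarrow> nat \<Rightarrow> (nat \<Rightarrow> 'a \<Rightarrow> real) \<Rightarrow> (nat \<Rightarrow> 'a \<Rightarrow> real) \<Rightarrow> nat \<Rightarrow> real" where
  "avg_throughput M \<Delta> n B X i =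
     measure M {\<omega> \<in> space M. received \<Delta> n (\<lambda>j. B j \<omega>) (\<lambda>j. X j \<omega>) i}"

end

theory Submission
  imports Defs
begin

text \<open>Put \<open>a = 1 + \<Delta>\<close> and \<open>Y k = B k * X k\<close>. In both models the \<open>Y k\<close> are independent, so
  conditioning on \<open>Y i\<close> writes the throughput as an integral of \<open>P (a * Y k < Y i)\<^sup>n\<^sup>-\<^sup>1\<close>.
  Without CSI it equals \<open>p * E (G (X i))\<close> for \<open>G y = (1 - p * exp (- y / a))\<^sup>n\<^sup>-\<^sup>1\<close>. With CSI and
  threshold \<open>t\<close>, the exponential law is memoryless, so the excess \<open>X i - t\<close>
  is again exponential given \<open>X i > t\<close>; the success probability given excess \<open>y\<close> is at most \<open>G y\<close>,
  because an interferer with gain above \<open>max t ((t + y) / a) \<le> t + y / a\<close> destroys the packet and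
  such a gain has probability at least \<open>p * exp (- y / a)\<close>.\<close>

section \<open>The capture condition as domination of every interferer\<close>

lemma received_iff:
  assumes "\<And>k. k \<in> {1..n} \<Longrightarrow> 0 \<le> b k * x k" and "0 \<le> \<Delta>"
  shows "received \<Delta> n b x i \<longleftrightarrow>
    0 < b i * x i \<and> (\<forall>k\<in>{1..n} - {i}. (1 + \<Delta>) * (b k * x k) < b i * x i)"
\<comment> \<open>With no interferers the maximum is read as 0, which the conjunct
  \<open>0 < b i * x i\<close> reproduces. Otherwise that conjunct follows from any one interferer,
  because its scaled signal is nonnegative.\<close>
proof (cases "{1..n} - {i} = {}")
  case True
  then show ?thesis by (auto simp: received_def max_or_zero_def)
next
  case False
  then obtain k where k: "k \<in> {1..n} - {i}" by blast
  have "0 \<le> (1 + \<Delta>) * (b k * x k)" using assms k mult_nonneg_nonneg[of "1 + \<Delta>" "b k * x k"] by auto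
  then have "0 < b i * x i" if "(1 + \<Delta>) * (b k * x k) < b i * x i" using that by linarith
  then show ?thesis using False k
    by (auto simp: received_def max_or_zero_def mult.assoc)
qed

section \<open>Independence and conditioning\<close>

lemma (in prob_space) indep_var_nn_integral_mult:
  assumes "indep_var borel f borel (g :: 'a \<Rightarrow> ennreal)"
  shows "(\<integral>\<^sup>+\<omega>. f \<omega> * g \<omega> \<partial>M) = (\<integral>\<^sup>+\<omega>. f \<omega> \<partial>M) * (\<integral>\<^sup>+\<omega>. g \<omega> \<partial>M)"
proof -
  have "case_bool borel borel = (\<lambda>_. borel :: ennreal measure)"
    by (auto split: bool.split)
  then have "indep_vars (\<lambda>_. borel) (case_bool f g) UNIV"
    using assms by (simp add: indep_var_def)
  from indep_vars_nn_integral[OF _ this] show ?thesis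
    by (simp add: UNIV_bool mult.commute)
qed

lemma (in prob_space) indep_var_restrict_component:
  assumes "indep_var (PiM I MA) (\<lambda>\<omega>. \<lambda>i\<in>I. A i \<omega>) (PiM I MB) (\<lambda>\<omega>. \<lambda>i\<in>I. B i \<omega>)" and "i \<in> I"
  shows "indep_var (MA i) (A i) (MB i) (B i)"
proof -
  have "indep_var (MA i) ((\<lambda>f. f i) \<circ> (\<lambda>\<omega>. \<lambda>i\<in>I. A i \<omega>)) (MB i) ((\<lambda>f. f i) \<circ> (\<lambda>\<omega>. \<lambda>i\<in>I. B i \<omega>))"
    using assms by (intro indep_var_compose[OF assms(1)]) measurable
  then show ?thesis using assms(2) by (simp add: comp_def)
qed

text \<open>Rectangle probabilities factor first between the two vectors and then over the indices
  within each; rectangles are an intersection-stable generator, so this suffices. Its use is to make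
  the products \<open>B k * X k\<close> independent when there is no CSI.\<close>

lemma (in prob_space) indep_vars_Pair:
  assumes I: "finite I" "I \<noteq> {}"
    and A: "indep_vars MA A I" and B: "indep_vars MB B I"
    and AB: "indep_var (PiM I MA) (\<lambda>\<omega>. \<lambda>i\<in>I. A i \<omega>) (PiM I MB) (\<lambda>\<omega>. \<lambda>i\<in>I. B i \<omega>)"
  shows "indep_vars (\<lambda>i. MA i \<Otimes>\<^sub>M MB i) (\<lambda>i \<omega>. (A i \<omega>, B i \<omega>)) I"
proof -
  define E where "E i = {a \<times> b | a b. a \<in> sets (MA i) \<and> b \<in> sets (MB i)}" for i
  have rv: "random_variable (MA i) (A i)" "random_variable (MB i) (B i)" if "i \<in> I" for i
    using A B that by (auto simp: indep_vars_def)
  have "prob (\<Inter>j\<in>I. (\<lambda>\<omega>. (A j \<omega>, B j \<omega>)) -` C j \<inter> space M) =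
      (\<Prod>j\<in>I. prob ((\<lambda>\<omega>. (A j \<omega>, B j \<omega>)) -` C j \<inter> space M))" if C: "C \<in> Pi I E" for C
  proof -
    have "\<forall>i\<in>I. \<exists>a b. C i = a \<times> b \<and> a \<in> sets (MA i) \<and> b \<in> sets (MB i)"
      using C by (auto simp: E_def Pi_iff)
    then obtain a b where ab: "\<And>i. i \<in> I \<Longrightarrow> C i = a i \<times> b i"
      "\<And>i. i \<in> I \<Longrightarrow> a i \<in> sets (MA i)" "\<And>i. i \<in> I \<Longrightarrow> b i \<in> sets (MB i)" by metis
    have "(\<Inter>j\<in>I. (\<lambda>\<omega>. (A j \<omega>, B j \<omega>)) -` C j \<inter> space M) =
        (\<lambda>\<omega>. (\<lambda>i\<in>I. A i \<omega>, \<lambda>i\<in>I. B i \<omega>)) -` (Pi\<^sub>E I a \<times> Pi\<^sub>E I b) \<inter> space M"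
      using I by (auto simp: ab PiE_iff)
    also have "prob \<dots> = prob ((\<lambda>\<omega>. \<lambda>i\<in>I. A i \<omega>) -` Pi\<^sub>E I a \<inter> space M) *
        prob ((\<lambda>\<omega>. \<lambda>i\<in>I. B i \<omega>) -` Pi\<^sub>E I b \<inter> space M)"
      using I ab by (intro indep_varD[OF AB] sets_PiM_I_finite) auto
    also have "(\<lambda>\<omega>. \<lambda>i\<in>I. A i \<omega>) -` Pi\<^sub>E I a \<inter> space M = (\<Inter>i\<in>I. A i -` a i \<inter> space M)"
      using I by (auto simp: PiE_iff)
    also have "(\<lambda>\<omega>. \<lambda>i\<in>I. B i \<omega>) -` Pi\<^sub>E I b \<inter> space M = (\<Inter>i\<in>I. B i -` b i \<inter> space M)"
      using I by (auto simp: PiE_iff)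
    also have "prob (\<Inter>i\<in>I. A i -` a i \<inter> space M) = (\<Prod>i\<in>I. prob (A i -` a i \<inter> space M))"
      using I ab by (intro indep_varsD_finite[OF A]) auto
    also have "prob (\<Inter>i\<in>I. B i -` b i \<inter> space M) = (\<Prod>i\<in>I. prob (B i -` b i \<inter> space M))"
      using I ab by (intro indep_varsD_finite[OF B]) auto
    \<comment> \<open>The two products are merged index by index, using that \<open>A j\<close> and
      \<open>B j\<close> are independent for each single \<open>j\<close>.\<close>
    also have "(\<Prod>i\<in>I. prob (A i -` a i \<inter> space M)) * (\<Prod>i\<in>I. prob (B i -` b i \<inter> space M)) =
        (\<Prod>j\<in>I. prob ((\<lambda>\<omega>. (A j \<omega>, B j \<omega>)) -` C j \<inter> space M))"
      unfolding prod.distrib[symmetric]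
      using ab by (intro prod.cong refl)
        (simp add: indep_varD[OF indep_var_restrict_component[OF AB]])
    finally show ?thesis .
  qed
  \<comment> \<open>Since each generator contains the whole space, the product formula over all of
    \<open>I\<close> already includes the one over every subset of \<open>I\<close>.\<close>
  moreover have "space (MA i \<Otimes>\<^sub>M MB i) \<in> E i" "E i \<subseteq> Pow (space (MA i \<Otimes>\<^sub>M MB i))" "Int_stable (E i)"
    "sets (MA i \<Otimes>\<^sub>M MB i) = sigma_sets (space (MA i \<Otimes>\<^sub>M MB i)) (E i)" for i
    by (auto simp: E_def space_pair_measure sets_pair_measure Int_stable_pair_measure_generator
        dest: sets.sets_into_space)
  ultimately show ?thesis
    using I rv by (subst indep_vars_finite[where E = E]) (auto intro: measurable_Pair)
qed

text \<open>By independence the joint law of \<open>Y i\<close> and of the remaining variables is a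
  product measure. Fubini integrates over the value of \<open>Y i\<close>, and each section is an
  intersection of independent events.\<close>

lemma (in prob_space) emeasure_indep_vars_dominates:
  fixes Y :: "'i \<Rightarrow> 'a \<Rightarrow> real"
  assumes Y: "indep_vars (\<lambda>_. borel) Y I" and I: "finite I" "i \<in> I"
  shows "emeasure M {\<omega> \<in> space M. 0 < Y i \<omega> \<and> (\<forall>k\<in>I - {i}. a * Y k \<omega> < Y i \<omega>)} =
    (\<integral>\<^sup>+\<omega>. indicator {0<..} (Y i \<omega>) *
      (\<Prod>k\<in>I - {i}. ennreal (prob {\<omega>' \<in> space M. a * Y k \<omega>' < Y i \<omega>})) \<partial>M)"
proof -
  define K where "K = I - {i}"
  have K: "finite K" "K \<subseteq> I" "i \<notin> K" using I by (auto simp: K_def)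
  have rv[measurable]: "random_variable borel (Y k)" if "k \<in> I" for k
    using Y that by (auto simp: indep_vars_def)
  define L where "L \<omega> = (\<lambda>k\<in>{i}. Y k \<omega>)" for \<omega>
  define R where "R \<omega> = (\<lambda>k\<in>K. Y k \<omega>)" for \<omega>
  let ?Q = "PiM {i} (\<lambda>_. borel :: real measure)"
  let ?P = "PiM K (\<lambda>_. borel :: real measure)"
  have L[measurable]: "random_variable ?Q L" and R[measurable]: "random_variable ?P R"
    unfolding L_def R_def using K I by (auto intro!: measurable_restrict rv)
  have "indep_var ?Q L ?P R"
    unfolding L_def R_def using K I by (intro indep_var_restrict[OF Y]) auto
  then have joint: "distr M ?Q L \<Otimes>\<^sub>M distr M ?P R = distr M (?Q \<Otimes>\<^sub>M ?P) (\<lambda>\<omega>. (L \<omega>, R \<omega>))"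
    by (simp add: indep_var_distribution_eq)
  interpret P: prob_space "distr M ?P R" by (rule prob_space_distr) measurable
  define D where "D = {z \<in> space (?Q \<Otimes>\<^sub>M ?P). 0 < fst z i \<and> (\<forall>k\<in>K. a * snd z k < fst z i)}"
  have D[measurable]: "D \<in> sets (?Q \<Otimes>\<^sub>M ?P)" unfolding D_def using K(1) by measurable
  have DL: "emeasure (distr M ?P R) (Pair (L \<omega>) -` D) = indicator {0<..} (Y i \<omega>) *
      (\<Prod>k\<in>K. ennreal (prob {\<omega>' \<in> space M. a * Y k \<omega>' < Y i \<omega>}))" for \<omega>
  proof -
    have L_space: "L \<omega> \<in> space ?Q" and Li: "L \<omega> i = Y i \<omega>"
      by (auto simp: L_def space_PiM)
    \<comment> \<open>An empty \<open>K\<close> is set apart: an intersection over no indices is the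
      whole type instead of \<open>space M\<close>, and the product formula for independent events
      asks for a nonempty index set.\<close>
    consider "Y i \<omega> \<le> 0" | "0 < Y i \<omega>" "K = {}" | "0 < Y i \<omega>" "K \<noteq> {}" by force
    then show ?thesis
    proof cases
      case 1
      then have "Pair (L \<omega>) -` D = {}" by (auto simp: D_def Li)
      then show ?thesis using 1 by (simp add: indicator_def)
    next
      case 2
      then have "Pair (L \<omega>) -` D = space (distr M ?P R)"
        using L_space by (auto simp: D_def space_pair_measure Li)
      then show ?thesis using 2 P.emeasure_space_1 by simp
    next
      case 3
      have "emeasure (distr M ?P R) (Pair (L \<omega>) -` D) = emeasure M (R -` (Pair (L \<omega>) -` D) \<inter> space M)"
        using D by (intro emeasure_distr) (auto dest: sets_Pair1)
      also have "R -` (Pair (L \<omega>) -` D) \<inter> space M = (\<Inter>k\<in>K. Y k -` {v. a * v < Y i \<omega>} \<inter> space M)"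
        using 3 L_space by (auto simp: D_def space_pair_measure Li) (auto simp: space_PiM R_def)
      also have "emeasure M \<dots> = ennreal (\<Prod>k\<in>K. prob (Y k -` {v. a * v < Y i \<omega>} \<inter> space M))"
        unfolding emeasure_eq_measure using K 3
        by (intro arg_cong[where f = ennreal] indep_varsD_finite[OF indep_vars_subset[OF Y]]) auto
      also have "\<dots> = (\<Prod>k\<in>K. ennreal (prob {\<omega>' \<in> space M. a * Y k \<omega>' < Y i \<omega>}))"
        by (subst prod_ennreal[symmetric])
          (auto intro!: prod.cong arg_cong[where f = prob] simp: vimage_def Int_def conj_commute)
      finally show ?thesis using 3 by simp
    qed
  qed
  have "{\<omega> \<in> space M. 0 < Y i \<omega> \<and> (\<forall>k\<in>K. a * Y k \<omega> < Y i \<omega>)} = (\<lambda>\<omega>. (L \<omega>, R \<omega>)) -` D \<inter> space M"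
    by (auto simp: D_def L_def R_def space_pair_measure space_PiM)
  also have "emeasure M \<dots> = emeasure (distr M ?Q L \<Otimes>\<^sub>M distr M ?P R) D"
    unfolding joint by (rule emeasure_distr[symmetric]) measurable
  also have "\<dots> = (\<integral>\<^sup>+l. emeasure (distr M ?P R) (Pair l -` D) \<partial>distr M ?Q L)"
    by (rule P.emeasure_pair_measure_alt) simp
  also have "\<dots> = (\<integral>\<^sup>+\<omega>. emeasure (distr M ?P R) (Pair (L \<omega>) -` D) \<partial>M)"
    using P.measurable_emeasure_Pair[of D ?Q] by (intro nn_integral_distr L) simp
  finally show ?thesis unfolding DL unfolding K_def .
qed

section \<open>The exponential law\<close>

lemma (in prob_space) exponential_memoryless_nn_integral:
  assumes X: "distributed M lborel X (exponential_density 1)" and t: "0 \<le> t"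
    and g[measurable]: "g \<in> borel_measurable borel"
  shows "(\<integral>\<^sup>+\<omega>. indicator {t<..} (X \<omega>) * g (X \<omega> - t) \<partial>M) =
    ennreal (exp (- t)) * (\<integral>\<^sup>+\<omega>. indicator {0<..} (X \<omega>) * g (X \<omega>) \<partial>M)"
proof -
  have "(\<integral>\<^sup>+\<omega>. indicator {t<..} (X \<omega>) * g (X \<omega> - t) \<partial>M) =
      (\<integral>\<^sup>+x. ennreal (exponential_density 1 x) * (indicator {t<..} x * g (x - t)) \<partial>lborel)"
    by (rule distributed_nn_integral[OF X, symmetric]) measurable
  also have "\<dots> = (\<integral>\<^sup>+x. ennreal (exponential_density 1 (t + 1 * x)) *
      (indicator {t<..} (t + 1 * x) * g (t + 1 * x - t)) \<partial>lborel)"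
    by (subst nn_integral_real_affine[where c = 1 and t = t]) auto
  \<comment> \<open>Memorylessness: after translation by \<open>t\<close> the density splits as
    \<open>exp (- t) * exp (- x)\<close>. For \<open>0 < x\<close> the assumption
    \<open>0 \<le> t\<close> keeps \<open>t + x\<close> in the nonzero branch of the
    density.\<close>
  also have "\<dots> = (\<integral>\<^sup>+x. ennreal (exp (- t)) *
      (ennreal (exponential_density 1 x) * (indicator {0<..} x * g x)) \<partial>lborel)"
    using t by (intro nn_integral_cong)
      (auto simp: exponential_density_def indicator_def mult_exp_exp ennreal_mult''[symmetric]
        mult.assoc[symmetric] split: if_splits)
  also have "\<dots> = ennreal (exp (- t)) *
      (\<integral>\<^sup>+x. ennreal (exponential_density 1 x) * (indicator {0<..} x * g x) \<partial>lborel)"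
    by (rule nn_integral_cmult) measurable
  also have "(\<integral>\<^sup>+x. ennreal (exponential_density 1 x) * (indicator {0<..} x * g x) \<partial>lborel) =
      (\<integral>\<^sup>+\<omega>. indicator {0<..} (X \<omega>) * g (X \<omega>) \<partial>M)"
    by (rule distributed_nn_integral[OF X]) measurable
  finally show ?thesis .
qed

text \<open>A law with a density has no atoms, so the weak and the strict tail agree. The weak tail
  arises because the negation of the strict capture inequality is weak.\<close>

lemma (in prob_space) exponential_distributedD_ge:
  assumes X: "distributed M lborel X (exponential_density l)" and t: "0 \<le> t" and l: "0 < l"
  shows "\<P>(\<omega> in M. t \<le> X \<omega>) = exp (- t * l)"
proof -
  have [measurable]: "random_variable borel X"
    using distributed_measurable[OF X] by simp
  have "AE x in lborel. x \<noteq> t" by (rule AE_lborel_singleton)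
  then have "AE x in density lborel (\<lambda>x. ennreal (exponential_density l x)). x \<noteq> t"
    by (subst AE_density) auto
  then have "AE x in distr M lborel X. x \<noteq> t"
    unfolding distributed_distr_eq_density[OF X] .
  then have "AE \<omega> in M. X \<omega> \<noteq> t"
    by (rule AE_distrD[rotated]) measurable
  then have "\<P>(\<omega> in M. t \<le> X \<omega>) = \<P>(\<omega> in M. t < X \<omega>)"
    by (intro finite_measure_eq_AE) auto
  then show ?thesis using exponential_distributedD_gt[OF X t l] by simp
qed

section \<open>Throughput in the two models\<close>

context rayleigh_fading
begin

lemma X_measurable [measurable]: "i \<in> {1..n} \<Longrightarrow> random_variable borel (X i)"
  using X_indep by (auto simp: indep_vars_def)

text \<open>The gains are fixed only in law, so the nonnegativity that \<open>received_iff\<close>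
  asks for holds off a null set.\<close>

lemma AE_X_pos: "AE \<omega> in M. \<forall>k\<in>{1..n}. 0 < X k \<omega>"
proof (rule AE_finite_allI)
  fix k assume k: "k \<in> {1..n}"
  have "\<P>(\<omega> in M. 0 < X k \<omega>) = 1"
    using exponential_distributedD_gt[OF X_exponential[OF k], of 0] by simp
  then show "AE \<omega> in M. 0 < X k \<omega>"
    using k by (subst (asm) prob_Collect_eq_1) auto
qed simp

text \<open>This serves both models: whether or not \<open>B k\<close> depends on
  \<open>X k\<close>, independence across nodes of the products \<open>B k * X k\<close> is what the
  conditioning on \<open>Y i\<close> uses.\<close>

lemma avg_throughput_eq_nn_integral:
  assumes Y: "indep_vars (\<lambda>_. borel) (\<lambda>k \<omega>. B k \<omega> * X k \<omega>) {1..n}"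
    and B: "\<And>k \<omega>. k \<in> {1..n} \<Longrightarrow> \<omega> \<in> space M \<Longrightarrow> 0 \<le> B k \<omega>"
    and B_measurable: "\<And>k. k \<in> {1..n} \<Longrightarrow> random_variable borel (B k)"
    and \<Delta>: "0 \<le> \<Delta>" and i: "i \<in> {1..n}"
  shows "ennreal (avg_throughput M \<Delta> n B X i) =
    (\<integral>\<^sup>+\<omega>. indicator {0<..} (B i \<omega> * X i \<omega>) *
      (\<Prod>k\<in>{1..n} - {i}. ennreal (\<P>(\<omega>' in M. (1 + \<Delta>) * (B k \<omega>' * X k \<omega>') < B i \<omega> * X i \<omega>))) \<partial>M)"
proof -
  note [measurable] = B_measurable
  have [measurable]: "Measurable.pred M (\<lambda>\<omega>. received \<Delta> n (\<lambda>j. B j \<omega>) (\<lambda>j. X j \<omega>) i)"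
    unfolding received_def max_or_zero_def using i
    by (cases "{1..n} - {i} = {}") (auto intro!: borel_measurable_less borel_measurable_Max)
  have "AE \<omega> in M. received \<Delta> n (\<lambda>j. B j \<omega>) (\<lambda>j. X j \<omega>) i \<longleftrightarrow>
      0 < B i \<omega> * X i \<omega> \<and> (\<forall>k\<in>{1..n} - {i}. (1 + \<Delta>) * (B k \<omega> * X k \<omega>) < B i \<omega> * X i \<omega>)"
    using AE_X_pos AE_space
  proof eventually_elim
    case (elim \<omega>)
    then show ?case using \<Delta> B by (intro received_iff) (auto simp: less_imp_le)
  qed
  then have "emeasure M {\<omega> \<in> space M. received \<Delta> n (\<lambda>j. B j \<omega>) (\<lambda>j. X j \<omega>) i} =
      emeasure M {\<omega> \<in> space M. 0 < B i \<omega> * X i \<omega> \<and>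
        (\<forall>k\<in>{1..n} - {i}. (1 + \<Delta>) * (B k \<omega> * X k \<omega>) < B i \<omega> * X i \<omega>)}"
    using i by (intro emeasure_eq_AE) auto
  also note emeasure_indep_vars_dominates[OF Y _ i]
  finally show ?thesis by (simp add: avg_throughput_def emeasure_eq_measure)
qed

text \<open>Once every interferer is bounded through \<open>jam\<close>, the integrand depends on
  \<open>X i\<close> only through its excess over \<open>t\<close>. Memorylessness then extracts
  \<open>exp (- t)\<close> and leaves the no-CSI integral for \<open>p = exp (- t)\<close>.\<close>

lemma avg_throughput_threshold_le:
  assumes t: "0 \<le> t" and \<Delta>: "0 \<le> \<Delta>" and i: "i \<in> {1..n}"
  shows "ennreal (avg_throughput M \<Delta> n (threshold_strategy (ereal t) X) X i) \<le>
    ennreal (exp (- t)) * (\<integral>\<^sup>+\<omega>. indicator {0<..} (X i \<omega>) *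
      ennreal (1 - exp (- t) * exp (- X i \<omega> / (1 + \<Delta>))) ^ (n - 1) \<partial>M)"
proof -
  define B where "B = threshold_strategy (ereal t) X"
  have B: "B k \<omega> = (if t < X k \<omega> then 1 else 0)" for k \<omega>
    by (simp add: B_def threshold_strategy_def)
  have "indep_vars (\<lambda>_. borel) (\<lambda>k \<omega>. (\<lambda>x. (if t < x then 1 else 0) * x) (X k \<omega>)) {1..n}"
    by (rule indep_vars_compose2[OF X_indep]) measurable
  then have Y: "indep_vars (\<lambda>_. borel) (\<lambda>k \<omega>. B k \<omega> * X k \<omega>) {1..n}" by (simp add: B)
  have jam: "\<P>(\<omega>' in M. (1 + \<Delta>) * (B k \<omega>' * X k \<omega>') < x) \<le>
      1 - exp (- t) * exp (- (x - t) / (1 + \<Delta>))" if k: "k \<in> {1..n}" and x: "t < x" for k x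
  proof -
    \<comment> \<open>A gain above \<open>m\<close> both passes the threshold and, scaled by
      \<open>1 + \<Delta>\<close>, exceeds \<open>x\<close>; so a packet of strength
      \<open>x\<close> survives interferer \<open>k\<close> only if \<open>X k\<close> is at most
      \<open>m\<close>.\<close>
    define m where "m = max t (x / (1 + \<Delta>))"
    \<comment> \<open>Splitting \<open>x\<close> as \<open>t + (x - t)\<close> reduces the bound on
      \<open>m\<close> to this inequality. The bound is an equality when \<open>t = 0\<close> or
      \<open>\<Delta> = 0\<close>.\<close>
    have "t / (1 + \<Delta>) \<le> t" using t \<Delta> by (simp add: field_simps)
    then have m: "m \<le> t + (x - t) / (1 + \<Delta>)"
      using x \<Delta> t by (auto simp: m_def diff_divide_distrib divide_le_cancel)
    have "exp (- t) * exp (- (x - t) / (1 + \<Delta>)) = exp (- (t + (x - t) / (1 + \<Delta>)))"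
      by (simp only: mult_exp_exp minus_divide_left minus_add_distrib)
    with m have "exp (- t) * exp (- (x - t) / (1 + \<Delta>)) \<le> exp (- m)" by simp
    moreover have "\<P>(\<omega>' in M. (1 + \<Delta>) * (B k \<omega>' * X k \<omega>') < x) \<le> \<P>(\<omega>' in M. X k \<omega>' \<le> m)"
      using k \<Delta> by (intro finite_measure_mono)
        (auto simp: B m_def le_max_iff_disj field_simps split: if_splits)
    moreover have "\<P>(\<omega>' in M. X k \<omega>' \<le> m) = 1 - exp (- m)"
      using exponential_distributedD_le[OF X_exponential[OF k], of m] t by (simp add: m_def)
    ultimately show ?thesis by simp
  qed
  have "ennreal (avg_throughput M \<Delta> n B X i) =
    (\<integral>\<^sup>+\<omega>. indicator {0<..} (B i \<omega> * X i \<omega>) *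
      (\<Prod>k\<in>{1..n} - {i}. ennreal (\<P>(\<omega>' in M. (1 + \<Delta>) * (B k \<omega>' * X k \<omega>') < B i \<omega> * X i \<omega>))) \<partial>M)"
    using Y \<Delta> i by (intro avg_throughput_eq_nn_integral) (auto simp: B[abs_def])
  also have "\<dots> \<le> (\<integral>\<^sup>+\<omega>. indicator {t<..} (X i \<omega>) *
      ennreal (1 - exp (- t) * exp (- (X i \<omega> - t) / (1 + \<Delta>))) ^ (n - 1) \<partial>M)"
  proof (intro nn_integral_mono)
    fix \<omega>
    show "indicator {0<..} (B i \<omega> * X i \<omega>) *
      (\<Prod>k\<in>{1..n} - {i}. ennreal (\<P>(\<omega>' in M. (1 + \<Delta>) * (B k \<omega>' * X k \<omega>') < B i \<omega> * X i \<omega>)))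
      \<le> indicator {t<..} (X i \<omega>) *
        ennreal (1 - exp (- t) * exp (- (X i \<omega> - t) / (1 + \<Delta>))) ^ (n - 1)"
    \<comment> \<open>Above the threshold the node transmits a positive signal and meets
      \<open>n - 1\<close> interferers; otherwise both indicators vanish.\<close>
    proof (cases "t < X i \<omega>")
      case True
      have "(\<Prod>k\<in>{1..n} - {i}. ennreal (\<P>(\<omega>' in M. (1 + \<Delta>) * (B k \<omega>' * X k \<omega>') < X i \<omega>)))
        \<le> (\<Prod>k\<in>{1..n} - {i}. ennreal (1 - exp (- t) * exp (- (X i \<omega> - t) / (1 + \<Delta>))))"
        using jam True by (intro prod_mono_ennreal ennreal_leI) auto
      then show ?thesis using True t i by (simp add: B card_Diff_singleton)
    qed (simp add: B)
  qed
  also have "\<dots> = ennreal (exp (- t)) * (\<integral>\<^sup>+\<omega>. indicator {0<..} (X i \<omega>) *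
      ennreal (1 - exp (- t) * exp (- X i \<omega> / (1 + \<Delta>))) ^ (n - 1) \<partial>M)"
    by (rule exponential_memoryless_nn_integral[OF X_exponential[OF i] t,
      where g = "\<lambda>x. ennreal (1 - exp (- t) * exp (- x / (1 + \<Delta>))) ^ (n - 1)"]) measurable
  finally show ?thesis by (simp add: B_def)
qed

end

text \<open>Each interferer's survival probability is exact here, and since the decision to transmit
  is independent of the gain, the factor \<open>p\<close> splits off from the integral over
  \<open>X i\<close>.\<close>

lemma (in no_csi) avg_throughput_no_csi:
  assumes \<Delta>: "0 \<le> \<Delta>" and i: "i \<in> {1..n}"
  shows "ennreal (avg_throughput M \<Delta> n B X i) =
    ennreal p * (\<integral>\<^sup>+\<omega>. indicator {0<..} (X i \<omega>) *
      ennreal (1 - p * exp (- X i \<omega> / (1 + \<Delta>))) ^ (n - 1) \<partial>M)"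
proof -
  let ?G = "\<lambda>x. indicator {0<..} x * ennreal (1 - p * exp (- x / (1 + \<Delta>))) ^ (n - 1)"
  have B_measurable [measurable]: "random_variable borel (B k)" if "k \<in> {1..n}" for k
    using B_indep that by (auto simp: indep_vars_def)
  have B01: "B k \<omega> = 0 \<or> B k \<omega> = 1" if "k \<in> {1..n}" "\<omega> \<in> space M" for k \<omega>
    using B_indicator[OF that] by auto
  have BX: "indep_var borel (B k) borel (X k)" if "k \<in> {1..n}" for k
    using indep_var_restrict_component[OF B_X_indep that] .
  have "indep_vars (\<lambda>_. borel \<Otimes>\<^sub>M borel) (\<lambda>k \<omega>. (B k \<omega>, X k \<omega>)) {1..n}"
    using i B_indep X_indep B_X_indep by (intro indep_vars_Pair) auto
  then have "indep_vars (\<lambda>_. borel) (\<lambda>k \<omega>. (\<lambda>(b, x). b * x) (B k \<omega>, X k \<omega>)) {1..n}"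
    by (rule indep_vars_compose2) measurable
  then have Y: "indep_vars (\<lambda>_. borel) (\<lambda>k \<omega>. B k \<omega> * X k \<omega>) {1..n}" by simp
  have jam: "\<P>(\<omega>' in M. (1 + \<Delta>) * (B k \<omega>' * X k \<omega>') < x) = 1 - p * exp (- x / (1 + \<Delta>))"
    if k: "k \<in> {1..n}" and x: "0 < x" for k x
  proof -
    have "\<P>(\<omega>' in M. (1 + \<Delta>) * (B k \<omega>' * X k \<omega>') < x) =
        1 - \<P>(\<omega>' in M. \<not> (1 + \<Delta>) * (B k \<omega>' * X k \<omega>') < x)"
      using k by (subst prob_neg) auto
    \<comment> \<open>As \<open>0 < x\<close>, an idle interferer does no harm, so destruction means
      transmitting with gain at least \<open>x / (1 + \<Delta>)\<close>. Set memberships give the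
      event the shape that the independence rule expects.\<close>
    also have "\<P>(\<omega>' in M. \<not> (1 + \<Delta>) * (B k \<omega>' * X k \<omega>') < x) =
        \<P>(\<omega>' in M. B k \<omega>' \<in> {1} \<and> X k \<omega>' \<in> {x / (1 + \<Delta>)..})"
      using B01[OF k] x \<Delta> by (intro arg_cong[where f = prob]) (fastforce simp: field_simps)
    also have "\<dots> = \<P>(\<omega>' in M. B k \<omega>' \<in> {1}) * \<P>(\<omega>' in M. X k \<omega>' \<in> {x / (1 + \<Delta>)..})"
      by (rule prob_indep_random_variable[OF BX[OF k]]) auto
    also have "\<dots> = p * exp (- x / (1 + \<Delta>))"
      using B_prob[OF k] x \<Delta> exponential_distributedD_ge[OF X_exponential[OF k], of "x / (1 + \<Delta>)"]
      by simp
    finally show ?thesis .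
  qed
  have "ennreal (avg_throughput M \<Delta> n B X i) =
    (\<integral>\<^sup>+\<omega>. indicator {0<..} (B i \<omega> * X i \<omega>) *
      (\<Prod>k\<in>{1..n} - {i}. ennreal (\<P>(\<omega>' in M. (1 + \<Delta>) * (B k \<omega>' * X k \<omega>') < B i \<omega> * X i \<omega>))) \<partial>M)"
    using Y \<Delta> i B_measurable B01 by (intro avg_throughput_eq_nn_integral) fastforce+
  \<comment> \<open>The integrand vanishes for \<open>B i = 0\<close> and depends on
    \<open>X i\<close> alone for \<open>B i = 1\<close>; it is thus a function of \<open>B i\<close>
    times a function of \<open>X i\<close>.\<close>
  also have "\<dots> = (\<integral>\<^sup>+\<omega>. indicator {1} (B i \<omega>) * ?G (X i \<omega>) \<partial>M)"
  proof (intro nn_integral_cong)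
    fix \<omega> assume "\<omega> \<in> space M"
    then consider "B i \<omega> = 0" | "B i \<omega> = 1" "X i \<omega> \<le> 0" | "B i \<omega> = 1" "0 < X i \<omega>"
      using B01[OF i] by force
    then show "indicator {0<..} (B i \<omega> * X i \<omega>) *
      (\<Prod>k\<in>{1..n} - {i}. ennreal (\<P>(\<omega>' in M. (1 + \<Delta>) * (B k \<omega>' * X k \<omega>') < B i \<omega> * X i \<omega>)))
      = indicator {1} (B i \<omega>) * ?G (X i \<omega>)"
      by cases (use i in \<open>simp_all add: jam card_Diff_singleton\<close>)
  qed
  also have "\<dots> = (\<integral>\<^sup>+\<omega>. indicator {1} (B i \<omega>) \<partial>M) * (\<integral>\<^sup>+\<omega>. ?G (X i \<omega>) \<partial>M)"
  proof (rule indep_var_nn_integral_mult)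
    have "indep_var borel (indicator {1} \<circ> B i) borel (?G \<circ> X i)"
      by (rule indep_var_compose[OF BX[OF i]]) measurable
    then show "indep_var borel (\<lambda>\<omega>. indicator {1} (B i \<omega>)) borel (\<lambda>\<omega>. ?G (X i \<omega>))"
      by (simp add: comp_def)
  qed
  also have "(\<integral>\<^sup>+\<omega>. indicator {1} (B i \<omega>) \<partial>M) = (\<integral>\<^sup>+\<omega>. indicator {\<omega> \<in> space M. B i \<omega> = 1} \<omega> \<partial>M)"
    by (intro nn_integral_cong) (simp add: indicator_def)
  also have "\<dots> = ennreal p"
    using i B_prob[OF i] by (simp add: emeasure_eq_measure)
  finally show ?thesis .
qed

section \<open>Comparison of the two throughputs\<close>

theorem theorem4:
  fixes M :: "'a measure" and n :: nat and \<Delta> p :: real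
    and X B :: "nat \<Rightarrow> 'a \<Rightarrow> real" and T :: ereal and i j :: nat
  assumes "n \<ge> 1" and "\<Delta> \<ge> 0" and "p \<in> {0..1}"
    and "no_csi M n X p B"
    and "T \<ge> 0" and "exp_neg T = p"
    and "i \<in> {1..n}" and "j \<in> {1..n}"
  shows "avg_throughput M \<Delta> n (threshold_strategy T X) X j \<le> avg_throughput M \<Delta> n B X i"
proof -
  interpret no_csi M n X p B by fact
  show ?thesis
  proof (cases T)
    case (real t)
    let ?g = "\<lambda>x. indicator {0<..} x * ennreal (1 - p * exp (- x / (1 + \<Delta>))) ^ (n - 1)"
    have t: "0 \<le> t" and p: "exp (- t) = p" using assms real by (auto simp: exp_neg_def)
    \<comment> \<open>The nodes \<open>i\<close> and \<open>j\<close> may differ; both gains have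
      the same density, so the two integrals coincide.\<close>
    have "(\<integral>\<^sup>+\<omega>. ?g (X j \<omega>) \<partial>M) = (\<integral>\<^sup>+\<omega>. ?g (X i \<omega>) \<partial>M)"
      using distributed_nn_integral[OF X_exponential[OF assms(7)], of ?g]
        distributed_nn_integral[OF X_exponential[OF assms(8)], of ?g] by simp
    with avg_throughput_threshold_le[OF t assms(2,8)] avg_throughput_no_csi[OF assms(2,7)]
    have "ennreal (avg_throughput M \<Delta> n (threshold_strategy T X) X j) \<le> ennreal (avg_throughput M \<Delta> n B X i)"
      by (simp add: p real)
    then show ?thesis by (simp add: avg_throughput_def)
  next
    case PInf
    \<comment> \<open>An infinite threshold silences every node, and a zero signal fails the strict
      inequality, so the throughput with CSI is 0.\<close>
    have "\<not> received \<Delta> n (\<lambda>k. 0) x j" for x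
      by (subst received_iff) (use assms(2) in auto)
    then show ?thesis by (simp add: avg_throughput_def threshold_strategy_def PInf)
  qed (use assms(5) in auto)
qed

end
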